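(* Let $(G_t)_{t\ge0}$ be the growing undirected graph generated by the generalized Aiello--Chung--Lu undirected model with random sequences $(X_t),(Y_t),(Z_t)$ (defined in the context). Let $\ell=\ell(n)$ and $u=u(n)$ be positive integers such that $X_t>0$ and $\ell\le X_t+Y_t+Z_t\le u$ for all $t\in\mathbb N$. Then there is a constant $C$, not depending on $n$, such that asymptotically almost surely (as $n\to\infty$) the diameter of $G_n$ is at most $4e(u/\ell)\log n+8eu+C$.
   Context: Conventions: $\mathbb N=\{1,2,\dots\}$, $\mathbb N_0=\{0,1,2,\dots\}$; $\log$ is the natural logarithm and $e$ its base. Graphs are finite and may have loops and parallel edges. The diameter is the maximum distance between two vertices. The initial graph $G_0$ is finite of size $O(1)$ (bounded independently of $n$). "Asymptotically almost surely" means with probability tending to $1$ as $n\to\infty$. Random choices at time $t$ have the stated distributions conditionally on the history of the process up to time $t-1$ and on the values $X_t,Y_t,Z_t$. For an undirected graph $G$, $\rho_0$ is the probability distribution on $V(G)$ given by $\rho_0(v)=\deg(v)/\sum_{u\in V(G)}\deg(u)$, where a loop is counted twice in the degree. Model: $(X_t)_{t\in\mathbb N}$ is a sequence of $\mathbb N$-valued random variables, and $(Y_t)_{t\in\mathbb N},(Z_t)_{t\in\mathbb N}$ are sequences of $\mathbb N_0$-valued random variables. $G_0$ is an arbitrary connected graph with at least one edge. At each time-step $t\in\mathbb N$, $G_t$ is obtained from $G_{t-1}$ as follows. 1. Sample $X_t$ vertices $N_1,\dots,N_{X_t}$ of $G_{t-1}$ independently using $\rho_0$. 2. Sample $2Z_t$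 vertices $W_1,W_1',\dots,W_{Z_t},W_{Z_t}'$ of $G_{t-1}$ independently using $\rho_0$. 3. Add a new vertex $v$ and the edges $W_1W_1',\dots,W_{Z_t}W_{Z_t}'$, $vN_1,\dots,vN_{X_t}$; also add $Y_t$ loops at $v$. *)

theory Defs
  imports "HOL-Probability.Probability" "HOL-Library.Uprod" "HOL-Library.Multiset"
begin

(* Undirected graphs with loops and parallel edges: the edges form a multiset of
   unordered pairs, and the loop at v is Upair v v. *)
record 'a mgraph =
  verts :: "'a set"
  edges :: "'a uprod multiset"

definition finite_mgraph :: "'a mgraph \<Rightarrow> bool" where
  "finite_mgraph G \<longleftrightarrow> finite (verts G) \<and> (\<forall>e \<in># edges G. set_uprod e \<subseteq> verts G)"

definition adj :: "'a mgraph \<Rightarrow> ('a \<times> 'a) set" where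
  "adj G = {(a, b). Upair a b \<in># edges G}"

definition connected_mgraph :: "'a mgraph \<Rightarrow> bool" where
  "connected_mgraph G \<longleftrightarrow> verts G \<noteq> {} \<and> (\<forall>a \<in> verts G. \<forall>b \<in> verts G. (a, b) \<in> (adj G)\<^sup>*)"

definition graph_degree :: "'a mgraph \<Rightarrow> 'a \<Rightarrow> nat" where
  "graph_degree G v = (\<Sum>e \<in># edges G. if e = Upair v v then 2 else if v \<in> set_uprod e then 1 else 0)"

definition rho0 :: "'a mgraph \<Rightarrow> 'a \<Rightarrow> real" where
  "rho0 G v = real (graph_degree G v) / real (\<Sum>w \<in> verts G. graph_degree G w)"

(* Minimal number of edges of a walk from a to b; infinite if there is none. *)
definition graph_dist :: "'a mgraph \<Rightarrow> 'a \<Rightarrow> 'a \<Rightarrow> enat" where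
  "graph_dist G a b = (INF k \<in> {k. (a, b) \<in> adj G ^^ k}. enat k)"

definition graph_diameter :: "'a mgraph \<Rightarrow> enat" where
  "graph_diameter G = (SUP a \<in> verts G. SUP b \<in> verts G. graph_dist G a b)"

(* In the growing graph, Inl a is the vertex a of the initial graph and Inr t is the
   vertex added at time-step t >= 1. *)
type_synonym 'v vert = "'v + nat"

definition init_graph :: "'v mgraph \<Rightarrow> 'v vert mgraph" where
  "init_graph G = \<lparr>verts = Inl ` verts G, edges = image_mset (map_uprod Inl) (edges G)\<rparr>"

definition step_graph ::
  "'a \<Rightarrow> nat \<Rightarrow> 'a list \<Rightarrow> ('a \<times> 'a) list \<Rightarrow> 'a mgraph \<Rightarrow> 'a mgraph" where
  "step_graph v y ns ws G =
     \<lparr>verts = insert v (verts G),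
      edges = edges G + image_mset (\<lambda>(w, w'). Upair w w') (mset ws)
                + image_mset (Upair v) (mset ns) + replicate_mset y (Upair v v)\<rparr>"

(* The graph after t steps, when in step s there are y s loops, ns s lists the sampled
   vertices N_1, N_2, ..., and ws s lists the sampled pairs (W_1,W_1'), (W_2,W_2'), ... *)
primrec acl_graph ::
  "'v mgraph \<Rightarrow> (nat \<Rightarrow> nat) \<Rightarrow> (nat \<Rightarrow> 'v vert list) \<Rightarrow> (nat \<Rightarrow> ('v vert \<times> 'v vert) list)
     \<Rightarrow> nat \<Rightarrow> 'v vert mgraph" where
  "acl_graph G0 y ns ws 0 = init_graph G0"
| "acl_graph G0 y ns ws (Suc t) =
     step_graph (Inr (Suc t)) (y (Suc t)) (ns (Suc t)) (ws (Suc t)) (acl_graph G0 y ns ws t)"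

(* The generalized Aiello-Chung-Lu undirected model.  Only the values at times t >= 1 of
   X, Y, Z, N, W matter.  The three sequences X, Y, Z may depend on each other and on the
   past of the process.  The assumption cond_samples is the conditional law of step t:
   given the samples of steps 1, ..., t-1 and the values of X, Y, Z at times 1, ..., t, the
   vertices sampled in step t are independent with distribution rho0 of the current graph. *)
locale acl_process = prob_space M for M :: "'w measure" +
  fixes G0 :: "'v mgraph"
    and X Y Z :: "nat \<Rightarrow> 'w \<Rightarrow> nat"
    and N :: "nat \<Rightarrow> 'w \<Rightarrow> 'v vert list"
    and W :: "nat \<Rightarrow> 'w \<Rightarrow> ('v vert \<times> 'v vert) list"
  assumes G0_finite: "finite_mgraph G0"
    and G0_connected: "connected_mgraph G0"
    and G0_edge: "edges G0 \<noteq> {#}"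
    and meas_X: "\<And>t. 1 \<le> t \<Longrightarrow> X t \<in> measurable M (count_space UNIV)"
    and meas_Y: "\<And>t. 1 \<le> t \<Longrightarrow> Y t \<in> measurable M (count_space UNIV)"
    and meas_Z: "\<And>t. 1 \<le> t \<Longrightarrow> Z t \<in> measurable M (count_space UNIV)"
    and meas_N: "\<And>t. 1 \<le> t \<Longrightarrow> N t \<in> measurable M (count_space UNIV)"
    and meas_W: "\<And>t. 1 \<le> t \<Longrightarrow> W t \<in> measurable M (count_space UNIV)"
    and X_pos: "\<And>t \<omega>. 1 \<le> t \<Longrightarrow> \<omega> \<in> space M \<Longrightarrow> 1 \<le> X t \<omega>"
    and N_length: "\<And>t \<omega>. 1 \<le> t \<Longrightarrow> \<omega> \<in> space M \<Longrightarrow> length (N t \<omega>) = X t \<omega>"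
    and W_length: "\<And>t \<omega>. 1 \<le> t \<Longrightarrow> \<omega> \<in> space M \<Longrightarrow> length (W t \<omega>) = Z t \<omega>"
    and N_verts: "\<And>t \<omega>. 1 \<le> t \<Longrightarrow> \<omega> \<in> space M \<Longrightarrow>
      set (N t \<omega>) \<subseteq> verts (acl_graph G0 (\<lambda>s. Y s \<omega>) (\<lambda>s. N s \<omega>) (\<lambda>s. W s \<omega>) (t - 1))"
    and W_verts: "\<And>t \<omega>. 1 \<le> t \<Longrightarrow> \<omega> \<in> space M \<Longrightarrow>
      set (W t \<omega>) \<subseteq> verts (acl_graph G0 (\<lambda>s. Y s \<omega>) (\<lambda>s. N s \<omega>) (\<lambda>s. W s \<omega>) (t - 1))
                  \<times> verts (acl_graph G0 (\<lambda>s. Y s \<omega>) (\<lambda>s. N s \<omega>) (\<lambda>s. W s \<omega>) (t - 1))"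
    and cond_samples: "\<And>t x y z ns ws. 1 \<le> t \<Longrightarrow>
      \<P>(\<omega> in M. (\<forall>s \<in> {1..<t}. N s \<omega> = ns s \<and> W s \<omega> = ws s) \<and>
                 (\<forall>s \<in> {1..t}. X s \<omega> = x s \<and> Y s \<omega> = y s \<and> Z s \<omega> = z s)) > 0 \<Longrightarrow>
      length (ns t) = x t \<Longrightarrow> length (ws t) = z t \<Longrightarrow>
      \<P>(\<omega> in M. N t \<omega> = ns t \<and> W t \<omega> = ws t \<bar>
                 (\<forall>s \<in> {1..<t}. N s \<omega> = ns s \<and> W s \<omega> = ws s) \<and>
                 (\<forall>s \<in> {1..t}. X s \<omega> = x s \<and> Y s \<omega> = y s \<and> Z s \<omega> = z s))
        = (\<Prod>v \<leftarrow> ns t. rho0 (acl_graph G0 y ns ws (t - 1)) v)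
          * (\<Prod>(w, w') \<leftarrow> ws t. rho0 (acl_graph G0 y ns ws (t - 1)) w
                             * rho0 (acl_graph G0 y ns ws (t - 1)) w')"

definition acl_random_graph ::
  "'v mgraph \<Rightarrow> (nat \<Rightarrow> 'w \<Rightarrow> nat) \<Rightarrow> (nat \<Rightarrow> 'w \<Rightarrow> 'v vert list)
     \<Rightarrow> (nat \<Rightarrow> 'w \<Rightarrow> ('v vert \<times> 'v vert) list) \<Rightarrow> nat \<Rightarrow> 'w \<Rightarrow> 'v vert mgraph" where
  "acl_random_graph G0 Y N W t \<omega> = acl_graph G0 (\<lambda>s. Y s \<omega>) (\<lambda>s. N s \<omega>) (\<lambda>s. W s \<omega>) t"

end

theory Submission
  imports Defs
begin

text \<open>
  Give the vertices of \<open>G\<^sub>0\<close> depth \<open>0\<close> and a new vertex the depth of its first sampled neighbour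
  plus one; the diameter is at most twice the maximal depth plus a constant.  Let \<open>S\<close> be the sum of
  \<open>deg v * 2 ^ depth v\<close> and \<open>T\<close> the sum of the degrees.  A step with \<open>m = X + Y + Z\<close> new edges
  increases the conditional expectation of \<open>S\<close> at most by the factor \<open>1 + 4m/T\<close>, and \<open>T\<close> exactly by
  the factor \<open>1 + 2m/T\<close>.  As \<open>1 + 4m/T \<le> (1 + 2m/T)\<^sup>2\<close>, the quotient \<open>S/T\<^sup>2\<close> is a supermartingale,
  for arbitrary history-dependent \<open>X, Y, Z\<close>.  By Markov's inequality \<open>S < n T\<^sup>2\<close> with probability at
  least \<open>1 - 1/n\<close>, and then every depth is at most \<open>(ln n + 2 ln T) / ln 2\<close>; since \<open>6 / ln 2 < 4e\<close>,
  this is better than required.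
\<close>

section \<open>Edge-additive functionals of a graph\<close>

text \<open>The factor 2 makes a loop count as two endpoints, as in \<open>graph_degree\<close>; the
  set \<open>set_uprod e\<close> alone would count it once.\<close>

definition end_sum :: "('a \<Rightarrow> real) \<Rightarrow> 'a uprod \<Rightarrow> real" where
  "end_sum f e = (\<Sum>v\<in>set_uprod e. (if e = Upair v v then 2 else 1) * f v)"

text \<open>Summing over edges instead of vertices makes the effect of new edges additive. The
  weight \<open>1\<close> gives the sum of degrees \<open>T\<close>, the weight
  \<open>2 ^ depth\<close> gives \<open>S\<close>.\<close>

definition edge_weight :: "('a \<Rightarrow> real) \<Rightarrow> 'a mgraph \<Rightarrow> real" where
  "edge_weight f G = (\<Sum>e\<in>#edges G. end_sum f e)"

lemma end_sum_Upair [simp]: "end_sum f (Upair a b) = f a + f b"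
  by (cases "a = b") (auto simp: end_sum_def)

lemma end_sum_cong: "(\<And>v. v \<in> set_uprod e \<Longrightarrow> f v = g v) \<Longrightarrow> end_sum f e = end_sum g e"
  by (cases e) simp

lemma edge_weight_const: "edge_weight (\<lambda>_. 1) G = 2 * real (size (edges G))"
proof -
  have "end_sum (\<lambda>_. 1) e = 2" for e :: "'a uprod"
    by (cases e) simp
  then show ?thesis
    by (simp add: edge_weight_def)
qed

lemma edge_weight_cong:
  assumes "finite_mgraph G" "\<And>v. v \<in> verts G \<Longrightarrow> f v = g v"
  shows "edge_weight f G = edge_weight g G"
  unfolding edge_weight_def using assms
  by (intro arg_cong[where f = sum_mset] image_mset_cong end_sum_cong)
     (auto simp: finite_mgraph_def)

lemma edge_weight_nonneg:
  assumes "\<And>v. 0 \<le> f v"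
  shows "0 \<le> edge_weight f G"
proof -
  have "0 \<le> (\<Sum>e\<in>#E. end_sum f e)" for E
    using assms by (induction E) (auto simp: end_sum_def intro!: add_nonneg_nonneg sum_nonneg)
  then show ?thesis
    by (simp add: edge_weight_def)
qed

text \<open>Handshake argument: \<open>c e v\<close> is the number of endpoints of \<open>e\<close>
  at \<open>v\<close>, and the double sum over edges and vertices is evaluated in both
  orders.\<close>

lemma edge_weight_degree:
  assumes "finite_mgraph G"
  shows "edge_weight f G = (\<Sum>v\<in>verts G. real (graph_degree G v) * f v)"
proof -
  define c :: "'a uprod \<Rightarrow> 'a \<Rightarrow> nat" where
    "c e v = (if e = Upair v v then 2 else if v \<in> set_uprod e then 1 else 0)" for e v
  have fin: "finite (verts G)"
    using assms by (simp add: finite_mgraph_def)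
  have "(\<Sum>v\<in>verts G. real (\<Sum>e\<in>#E. c e v) * f v) = (\<Sum>e\<in>#E. end_sum f e)"
    if "\<forall>e\<in>#E. set_uprod e \<subseteq> verts G" for E
    using that
  proof (induction E)
    case (add e E)
    have "(\<Sum>v\<in>verts G. real (c e v) * f v) = (\<Sum>v\<in>set_uprod e. real (c e v) * f v)"
      using add.prems fin by (intro sum.mono_neutral_right) (auto simp: c_def)
    also have "\<dots> = end_sum f e"
      unfolding end_sum_def by (intro sum.cong) (auto simp: c_def)
    finally show ?case
      using add by (simp add: algebra_simps sum.distrib)
  qed simp
  with assms show ?thesis
    by (simp add: edge_weight_def graph_degree_def c_def finite_mgraph_def)
qed

text \<open>The vertex \<open>v\<close> gains one endpoint from each edge to a sampled neighbour and
  two from each loop; each sampled vertex gains one endpoint per draw.\<close>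

lemma edge_weight_step:
  "edge_weight f (step_graph v y ns ws G) =
     edge_weight f G + (real (length ns) + 2 * real y) * f v + sum_list (map f ns)
       + (\<Sum>(w, w')\<leftarrow>ws. f w + f w')"
proof -
  have 1: "(\<Sum>e\<in>#image_mset (Upair v) (mset ns). end_sum f e) = real (length ns) * f v + sum_list (map f ns)"
    by (induction ns) (auto simp: algebra_simps)
  have 2: "(\<Sum>e\<in>#image_mset (\<lambda>(w, w'). Upair w w') (mset ws). end_sum f e) = (\<Sum>(w, w')\<leftarrow>ws. f w + f w')"
    by (induction ws) (auto simp: algebra_simps)
  have 3: "(\<Sum>e\<in>#replicate_mset y (Upair v v). end_sum f e) = 2 * real y * f v"
    by (induction y) (auto simp: algebra_simps)
  show ?thesis
    unfolding edge_weight_def step_graph_def select_convs image_mset_union sum_mset.union 1 2 3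
    by (simp add: algebra_simps)
qed

lemma finite_mgraph_step:
  assumes "finite_mgraph G" "set ns \<subseteq> verts G" "set ws \<subseteq> verts G \<times> verts G"
  shows "finite_mgraph (step_graph v y ns ws G)"
  using assms unfolding finite_mgraph_def step_graph_def
  by (auto simp: in_replicate_mset split: if_splits)

text \<open>Sampling by degree turns the mean of \<open>2 ^ depth\<close> at a sampled vertex into
  exactly \<open>S/T\<close>, which is why a degree-weighted potential closes up under a
  step.\<close>

lemma sum_rho0:
  assumes "finite_mgraph G"
  shows "(\<Sum>v\<in>verts G. rho0 G v * f v) = edge_weight f G / edge_weight (\<lambda>_. 1) G"
  unfolding edge_weight_degree[OF assms] rho0_def
  by (simp add: sum_divide_distrib)

section \<open>Sums over samples of independent draws\<close>

lemma sum_lists_Suc: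
  "(\<Sum>xs | set xs \<subseteq> V \<and> length xs = Suc n. g xs) =
     (\<Sum>v\<in>V. \<Sum>xs | set xs \<subseteq> V \<and> length xs = n. g (v # xs))"
proof -
  have "(\<Sum>xs | set xs \<subseteq> V \<and> length xs = Suc n. g xs) =
     (\<Sum>(xs, v)\<in>{xs. set xs \<subseteq> V \<and> length xs = n} \<times> V. g (v # xs))"
    unfolding lists_length_Suc_eq by (subst sum.reindex) (auto simp: inj_on_def case_prod_unfold)
  also have "\<dots> = (\<Sum>v\<in>V. \<Sum>xs | set xs \<subseteq> V \<and> length xs = n. g (v # xs))"
    by (subst sum.swap) (simp add: sum.cartesian_product)
  finally show ?thesis .
qed

lemma sum_lists_prod:
  fixes p :: "'a \<Rightarrow> real"
  assumes "(\<Sum>v\<in>V. p v) = 1"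
  shows "(\<Sum>xs | set xs \<subseteq> V \<and> length xs = n. \<Prod>v\<leftarrow>xs. p v) = 1"
proof (induction n)
  case 0
  have "{xs. set xs \<subseteq> V \<and> length xs = 0} = {[]}" by auto
  then show ?case by simp
next
  case (Suc n)
  then show ?case
    unfolding sum_lists_Suc by (simp add: sum_distrib_left[symmetric] assms)
qed

text \<open>Linearity of expectation for \<open>n\<close> independent draws, by splitting off the
  first draw.\<close>

lemma sum_lists_sum:
  fixes p f :: "'a \<Rightarrow> real"
  assumes "(\<Sum>v\<in>V. p v) = 1"
  shows "(\<Sum>xs | set xs \<subseteq> V \<and> length xs = n. (\<Prod>v\<leftarrow>xs. p v) * sum_list (map f xs)) =
    real n * (\<Sum>v\<in>V. p v * f v)"
proof (induction n)
  case 0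
  have "{xs. set xs \<subseteq> V \<and> length xs = 0} = {[]}" by auto
  then show ?case by simp
next
  case (Suc n)
  have "(\<Sum>xs | set xs \<subseteq> V \<and> length xs = n. (\<Prod>v\<leftarrow>w # xs. p v) * sum_list (map f (w # xs))) =
      p w * f w * (\<Sum>xs | set xs \<subseteq> V \<and> length xs = n. \<Prod>v\<leftarrow>xs. p v)
      + p w * (\<Sum>xs | set xs \<subseteq> V \<and> length xs = n. (\<Prod>v\<leftarrow>xs. p v) * sum_list (map f xs))" for w
    unfolding sum_distrib_left sum.distrib[symmetric]
    by (intro sum.cong) (simp_all add: algebra_simps)
  then have "(\<Sum>xs | set xs \<subseteq> V \<and> length xs = Suc n. (\<Prod>v\<leftarrow>xs. p v) * sum_list (map f xs)) =
      (\<Sum>w\<in>V. p w * f w) + (\<Sum>w\<in>V. p w) * (real n * (\<Sum>v\<in>V. p v * f v))"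
    unfolding sum_lists_Suc sum_lists_prod[OF assms] Suc sum_distrib_right
    by (simp only: sum.distrib mult_1_right)
  then show ?case
    by (simp add: assms algebra_simps)
qed

text \<open>The draws after the first one sum out to 1, so only the law of the first
  remains.\<close>

lemma sum_lists_hd:
  fixes p f :: "'a \<Rightarrow> real"
  assumes "(\<Sum>v\<in>V. p v) = 1" "0 < n"
  shows "(\<Sum>xs | set xs \<subseteq> V \<and> length xs = n. (\<Prod>v\<leftarrow>xs. p v) * f (hd xs)) = (\<Sum>v\<in>V. p v * f v)"
proof -
  obtain m where n: "n = Suc m"
    using assms(2) by (cases n) auto
  have "(\<Sum>xs | set xs \<subseteq> V \<and> length xs = m. (\<Prod>v\<leftarrow>w # xs. p v) * f (hd (w # xs))) =
      p w * f w * (\<Sum>xs | set xs \<subseteq> V \<and> length xs = m. \<Prod>v\<leftarrow>xs. p v)" for w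
    by (simp add: sum_distrib_left algebra_simps)
  then show ?thesis
    unfolding n sum_lists_Suc by (simp add: sum_lists_prod[OF assms(1)])
qed

text \<open>Shape of the conditional mean of \<open>S\<close> after a step: \<open>c\<close> will be
  the old \<open>S\<close> and \<open>b\<close> the coefficient of the parent's weight. Every draw,
  including the first neighbour, has mean \<phi>.\<close>

lemma sum_independent_samples:
  fixes p f :: "'a \<Rightarrow> real"
  assumes p: "(\<Sum>v\<in>V. p v) = 1" and n: "0 < n"
  defines "\<phi> \<equiv> \<Sum>v\<in>V. p v * f v"
  shows "(\<Sum>(ns, ws)\<in>{ns. set ns \<subseteq> V \<and> length ns = n} \<times> {ws. set ws \<subseteq> V \<times> V \<and> length ws = m}.
      (c + b * f (hd ns) + sum_list (map f ns) + (\<Sum>(w, w')\<leftarrow>ws. f w + f w'))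
        * ((\<Prod>v\<leftarrow>ns. p v) * (\<Prod>(w, w')\<leftarrow>ws. p w * p w'))) =
    c + b * \<phi> + real n * \<phi> + 2 * real m * \<phi>"
proof -
  let ?A = "{ns. set ns \<subseteq> V \<and> length ns = n}"
  let ?B = "{ws. set ws \<subseteq> V \<times> V \<and> length ws = m}"
  define P where "P xs = (\<Prod>v\<leftarrow>xs. p v)" for xs
  \<comment> \<open>A pair is treated as one draw from the product distribution on
    \<open>V \<times> V\<close>, so that the lemmas on lists of draws also apply to
    \<open>ws\<close>.\<close>
  define p2 where "p2 = (\<lambda>(w, w'). p w * p w')"
  define f2 where "f2 = (\<lambda>(w, w'). f w + f w')"
  define Q where "Q ws = (\<Prod>v\<leftarrow>ws. p2 v)" for ws
  have p2: "(\<Sum>v\<in>V \<times> V. p2 v) = 1"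
    using p by (simp add: p2_def sum.cartesian_product[symmetric] sum_distrib_left[symmetric])
  have "(\<Sum>v\<in>V \<times> V. p2 v * f2 v) = (\<Sum>w\<in>V. \<Sum>w'\<in>V. (p w * f w) * p w' + p w * (p w' * f w'))"
    unfolding p2_def f2_def sum.cartesian_product by (intro sum.cong) (auto simp: algebra_simps)
  also have "\<dots> = 2 * \<phi>"
    by (simp add: sum.distrib sum_distrib_left[symmetric] sum_distrib_right[symmetric] p \<phi>_def)
  finally have f2: "(\<Sum>v\<in>V \<times> V. p2 v * f2 v) = 2 * \<phi>" .
  have P1: "sum P ?A = 1" unfolding P_def by (rule sum_lists_prod[OF p])
  have Q1: "sum Q ?B = 1" unfolding Q_def by (rule sum_lists_prod[OF p2])
  have Pf: "(\<Sum>ns\<in>?A. P ns * sum_list (map f ns)) = real n * \<phi>"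
    unfolding P_def \<phi>_def by (rule sum_lists_sum[OF p])
  have Qf: "(\<Sum>ws\<in>?B. Q ws * sum_list (map f2 ws)) = real m * (2 * \<phi>)"
    unfolding Q_def f2[symmetric] by (rule sum_lists_sum[OF p2])
  have Ph: "(\<Sum>ns\<in>?A. P ns * f (hd ns)) = \<phi>"
    unfolding P_def \<phi>_def by (rule sum_lists_hd[OF p n])
  have "(\<Sum>(ns, ws)\<in>?A \<times> ?B.
      (c + b * f (hd ns) + sum_list (map f ns) + sum_list (map f2 ws)) * (P ns * Q ws)) =
     (\<Sum>ns\<in>?A. \<Sum>ws\<in>?B. (c * P ns + b * (P ns * f (hd ns)) + P ns * sum_list (map f ns)) * Q ws
        + P ns * (Q ws * sum_list (map f2 ws)))"
    unfolding sum.cartesian_product by (intro sum.cong) (auto simp: algebra_simps)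
  also have "\<dots> = c + b * \<phi> + real n * \<phi> + 2 * real m * \<phi>"
    by (simp add: sum.distrib sum_distrib_left[symmetric] sum_distrib_right[symmetric] P1 Q1 Pf Qf Ph)
  finally show ?thesis
    by (simp add: P_def Q_def p2_def f2_def)
qed

section \<open>Distances\<close>

lemma sym_adj: "sym (adj G)"
proof (rule symI)
  fix a b
  assume "(a, b) \<in> adj G"
  moreover have "Upair a b = Upair b a" by simp
  ultimately show "(b, a) \<in> adj G" by (simp only: adj_def mem_Collect_eq case_prod_conv)
qed

lemma relpow_sym: "sym r \<Longrightarrow> (a, b) \<in> r ^^ k \<Longrightarrow> (b, a) \<in> r ^^ k"
proof (induction k arbitrary: b)
  case (Suc k)
  then obtain c where "(a, c) \<in> r ^^ k" "(c, b) \<in> r" by auto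
  with Suc have "(b, c) \<in> r" "(c, a) \<in> r ^^ k" by (auto dest: symD)
  then show ?case by (rule relpow_Suc_I2)
qed auto

lemma graph_dist_le: "(a, b) \<in> adj G ^^ k \<Longrightarrow> graph_dist G a b \<le> enat k"
  unfolding graph_dist_def by (intro INF_lower) auto

lemma adj_step: "adj (step_graph v y ns ws G) \<supseteq> adj G"
  by (auto simp: adj_def step_graph_def)

lemma adj_init:
  assumes "(a, b) \<in> adj G ^^ k"
  shows "(Inl a, Inl b) \<in> adj (init_graph G) ^^ k"
  using assms
proof (induction k arbitrary: b)
  case (Suc k)
  then obtain c where "(a, c) \<in> adj G ^^ k" "(c, b) \<in> adj G" by auto
  moreover from this have "(Inl c, Inl b) \<in> adj (init_graph G)"
    by (force simp: adj_def init_graph_def)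
  ultimately show ?case using Suc by auto
qed auto

text \<open>In a finite relation reachability is attained by a power not exceeding the number of
  related pairs. This crude bound suffices, since it is constant for an initial graph of bounded
  size.\<close>

lemma connected_short_path:
  assumes "finite_mgraph G" "connected_mgraph G" "a \<in> verts G" "b \<in> verts G"
  obtains k where "k \<le> (card (verts G))\<^sup>2" "(a, b) \<in> adj G ^^ k"
proof -
  have sub: "adj G \<subseteq> verts G \<times> verts G" and fin: "finite (verts G)"
    using assms(1) by (fastforce simp: adj_def finite_mgraph_def)+
  then have "finite (adj G)" and "card (adj G) \<le> (card (verts G))\<^sup>2"
    using card_mono[OF _ sub] finite_subset[OF sub] by (auto simp: power2_eq_square card_cartesian_product)
  moreover have "(a, b) \<in> (adj G)\<^sup>*"
    using assms by (auto simp: connected_mgraph_def)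
  ultimately show ?thesis
    using that le_trans unfolding rtrancl_finite_eq_relpow[OF \<open>finite (adj G)\<close>] by blast
qed

section \<open>Depth in the growing graph\<close>

text \<open>The first sampled neighbour acts as the parent. Vertices that do not exist yet at time
  \<open>t\<close> have the default depth 0, and later steps leave the depth of an existing vertex
  unchanged.\<close>

primrec depth :: "(nat \<Rightarrow> 'v vert list) \<Rightarrow> nat \<Rightarrow> 'v vert \<Rightarrow> nat" where
  "depth ns 0 = (\<lambda>v. 0)"
| "depth ns (Suc t) = (depth ns t)(Inr (Suc t) := Suc (depth ns t (hd (ns (Suc t)))))"

lemma depth_Inl [simp]: "depth ns t (Inl a) = 0"
  by (induction t) auto

lemma depth_cong: "(\<And>s. 1 \<le> s \<Longrightarrow> s \<le> t \<Longrightarrow> ns s = ns' s) \<Longrightarrow> depth ns t = depth ns' t"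
  by (induction t) auto

lemma acl_graph_cong:
  "(\<And>s. 1 \<le> s \<Longrightarrow> s \<le> t \<Longrightarrow> y s = y' s \<and> ns s = ns' s \<and> ws s = ws' s) \<Longrightarrow>
    acl_graph G0 y ns ws t = acl_graph G0 y' ns' ws' t"
  by (induction t) auto

lemma verts_acl_graph: "verts (acl_graph G0 y ns ws t) = Inl ` verts G0 \<union> Inr ` {1..t}"
  by (induction t) (auto simp: init_graph_def step_graph_def atLeastAtMostSuc_conv)

lemma size_edges_acl_graph:
  "size (edges (acl_graph G0 y ns ws t)) =
     size (edges G0) + (\<Sum>s = 1..t. length (ns s) + y s + length (ws s))"
  by (induction t) (auto simp: init_graph_def step_graph_def)

lemma relpow_mono_rel: "r \<subseteq> s \<Longrightarrow> r ^^ k \<subseteq> s ^^ k"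
  for r s :: "('a \<times> 'a) set"
  by (induction k) (auto intro: relcomp_mono)

text \<open>Following parents leads back to the initial graph: the parent is an older vertex, and
  its path survives because edges are only added.\<close>

lemma depth_path:
  assumes "\<And>s. 1 \<le> s \<Longrightarrow> s \<le> t \<Longrightarrow> ns s \<noteq> [] \<and> set (ns s) \<subseteq> verts (acl_graph G0 y ns ws (s - 1))"
    and "v \<in> verts (acl_graph G0 y ns ws t)"
  shows "\<exists>a\<in>verts G0. (v, Inl a) \<in> adj (acl_graph G0 y ns ws t) ^^ depth ns t v"
  using assms
proof (induction t arbitrary: v)
  case 0
  then show ?case by (auto simp: init_graph_def)
next
  case (Suc t)
  let ?G = "acl_graph G0 y ns ws"
  have path: "\<exists>a\<in>verts G0. (w, Inl a) \<in> adj (?G (Suc t)) ^^ depth ns t w" if "w \<in> verts (?G t)" for w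
  proof -
    obtain a where "a \<in> verts G0" "(w, Inl a) \<in> adj (?G t) ^^ depth ns t w"
      using Suc.IH[OF Suc.prems(1) \<open>w \<in> verts (?G t)\<close>] by auto
    then show ?thesis
      using relpow_mono_rel[OF adj_step] by fastforce
  qed
  show ?case
  proof (cases "v = Inr (Suc t)")
    case True
    let ?w = "hd (ns (Suc t))"
    have "?w \<in> set (ns (Suc t))" "set (ns (Suc t)) \<subseteq> verts (?G t)"
      using Suc.prems(1)[of "Suc t"] by auto
    moreover from this have "(v, ?w) \<in> adj (?G (Suc t))"
      unfolding True by (auto simp: adj_def step_graph_def)
    moreover obtain a where "a \<in> verts G0" "(?w, Inl a) \<in> adj (?G (Suc t)) ^^ depth ns t ?w"
      using path[of ?w] calculation by blast
    ultimately have "(v, Inl a) \<in> adj (?G (Suc t)) ^^ Suc (depth ns t ?w)"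
      by (blast intro: relpow_Suc_I2)
    with \<open>a \<in> verts G0\<close> show ?thesis
      using True by (auto simp del: relpow.simps acl_graph.simps)
  next
    case False
    with Suc.prems(2) path[of v] show ?thesis
      by (auto simp: step_graph_def)
  qed
qed

lemma acl_init_adj: "adj (init_graph G0) \<subseteq> adj (acl_graph G0 y ns ws t)"
proof (induction t)
  case (Suc t)
  also note adj_step
  finally show ?case by simp
qed simp

text \<open>Route from \<open>v\<close> up to the initial graph, across it, and down to
  \<open>w\<close>.\<close>

lemma diameter_acl_graph_le:
  assumes G0: "finite_mgraph G0" "connected_mgraph G0"
    and "\<And>s. 1 \<le> s \<Longrightarrow> s \<le> t \<Longrightarrow> ns s \<noteq> [] \<and> set (ns s) \<subseteq> verts (acl_graph G0 y ns ws (s - 1))"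
    and d: "\<And>v. v \<in> verts (acl_graph G0 y ns ws t) \<Longrightarrow> depth ns t v \<le> d"
  shows "graph_diameter (acl_graph G0 y ns ws t) \<le> enat (2 * d + (card (verts G0))\<^sup>2)"
proof -
  let ?G = "acl_graph G0 y ns ws t"
  have "graph_dist ?G v w \<le> enat (2 * d + (card (verts G0))\<^sup>2)"
    if v: "v \<in> verts ?G" and w: "w \<in> verts ?G" for v w
  proof -
    obtain a where a: "a \<in> verts G0" "(v, Inl a) \<in> adj ?G ^^ depth ns t v"
      using depth_path[OF assms(3) v] by auto
    obtain b where b: "b \<in> verts G0" "(w, Inl b) \<in> adj ?G ^^ depth ns t w"
      using depth_path[OF assms(3) w] by auto
    obtain k where k: "k \<le> (card (verts G0))\<^sup>2" "(a, b) \<in> adj G0 ^^ k"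
      using connected_short_path[OF G0 a(1) b(1)] .
    have "(Inl a, Inl b) \<in> adj ?G ^^ k"
      using relpow_mono_rel[OF acl_init_adj] adj_init[OF k(2)] by blast
    moreover have "(Inl b, w) \<in> adj ?G ^^ depth ns t w"
      using b(2) by (rule relpow_sym[OF sym_adj])
    ultimately have "(v, w) \<in> adj ?G ^^ (depth ns t v + k + depth ns t w)"
      using a(2) unfolding relpow_add by blast
    then have "graph_dist ?G v w \<le> enat (depth ns t v + k + depth ns t w)"
      by (rule graph_dist_le)
    also have "\<dots> \<le> enat (2 * d + (card (verts G0))\<^sup>2)"
      using d[OF v] d[OF w] k(1) by simp
    finally show ?thesis .
  qed
  then show ?thesis
    unfolding graph_diameter_def by (intro SUP_least)
qed

lemma edge_weight_ge:
  assumes "\<And>v. 0 \<le> f v" "Upair a b \<in># edges G"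
  shows "f a \<le> edge_weight f G"
proof -
  obtain E where "edges G = add_mset (Upair a b) E"
    using assms(2) by (auto dest: multi_member_split)
  then have "edge_weight f G = f a + f b + edge_weight f (G\<lparr>edges := E\<rparr>)"
    by (simp add: edge_weight_def)
  then show ?thesis
    using assms(1)[of b] edge_weight_nonneg[of f "G\<lparr>edges := E\<rparr>"] assms(1) by simp
qed

text \<open>The edge from a new vertex to its parent gives it positive degree, so its own
  \<open>2 ^ depth\<close> is one of the nonnegative contributions to \<open>S\<close>.\<close>

lemma depth_le_edge_weight:
  assumes "\<And>s. 1 \<le> s \<Longrightarrow> s \<le> t \<Longrightarrow> ns s \<noteq> []"
    and "1 \<le> s" "s \<le> t"
  shows "2 ^ depth ns t (Inr s) \<le> edge_weight (\<lambda>v. 2 ^ depth ns t v) (acl_graph G0 y ns ws t)"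
proof (rule edge_weight_ge)
  show "Upair (Inr s) (hd (ns s)) \<in># edges (acl_graph G0 y ns ws t)"
    using assms
  proof (induction t)
    case (Suc t)
    have "hd (ns (Suc t)) \<in> set (ns (Suc t))"
      using Suc.prems(1)[of "Suc t"] by simp
    then show ?case
      using Suc by (cases "s = Suc t") (auto simp: step_graph_def)
  qed simp
qed simp

section \<open>Finite histories\<close>

text \<open>Such an \<open>f\<close> factors through \<open>h\<close>, so each preimage is a finite
  union of measurable fibres.\<close>

lemma finite_fibres_measurable:
  assumes "finite (h ` space M)"
    and "\<And>\<omega>. \<omega> \<in> space M \<Longrightarrow> h -` {h \<omega>} \<inter> space M \<in> sets M"
    and "\<And>\<omega> \<omega>'. \<omega> \<in> space M \<Longrightarrow> \<omega>' \<in> space M \<Longrightarrow> h \<omega> = h \<omega>' \<Longrightarrow> f \<omega> = f \<omega>'"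
  shows "f \<in> measurable M (count_space UNIV)"
proof (rule measurableI)
  fix A
  have eq: "f -` A \<inter> space M = (\<Union>k\<in>h ` {\<omega> \<in> space M. f \<omega> \<in> A}. h -` {k} \<inter> space M)"
    using assms(3) by blast
  have "finite (h ` {\<omega> \<in> space M. f \<omega> \<in> A})"
    using assms(1) by (rule finite_subset[rotated]) auto
  then show "f -` A \<inter> space M \<in> sets M"
    unfolding eq by (rule sets.finite_UN) (use assms(2) in auto)
qed auto

context finite_measure
begin

lemma finite_fibres_integrable:
  fixes f :: "'a \<Rightarrow> real"
  assumes "finite (h ` space M)"
    and "\<And>\<omega>. \<omega> \<in> space M \<Longrightarrow> h -` {h \<omega>} \<inter> space M \<in> sets M"
    and "\<And>\<omega> \<omega>'. \<omega> \<in> space M \<Longrightarrow> \<omega>' \<in> space M \<Longrightarrow> h \<omega> = h \<omega>' \<Longrightarrow> f \<omega> = f \<omega>'"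
  shows "integrable M f"
proof (rule integrable_const_bound)
  have "f \<in> measurable M (count_space UNIV)"
    using assms by (rule finite_fibres_measurable)
  then show "f \<in> borel_measurable M"
    by (rule measurable_compose) simp
  \<comment> \<open>A representative of each fibre shows that \<open>f\<close> takes finitely many
    values; the sum of their absolute values is then a bound.\<close>
  let ?r = "\<lambda>k. SOME \<omega>. \<omega> \<in> space M \<and> h \<omega> = k"
  have "f \<omega> = f (?r (h \<omega>))" if "\<omega> \<in> space M" for \<omega>
  proof -
    have "?r (h \<omega>) \<in> space M \<and> h (?r (h \<omega>)) = h \<omega>"
      by (rule someI[of _ \<omega>]) (use that in simp)
    then show ?thesis
      using that by (intro assms(3)) simp_all
  qed
  then have "f ` space M \<subseteq> (\<lambda>k. f (?r k)) ` h ` space M" by blast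
  then have "finite (f ` space M)"
    using assms(1) finite_surj by blast
  then show "AE \<omega> in M. norm (f \<omega>) \<le> (\<Sum>x\<in>f ` space M. \<bar>x\<bar>)"
    by (auto intro!: AE_I2 member_le_sum)
qed

text \<open>An elementary tower property: the fibres of \<open>h\<close> partition the space into
  finitely many atoms, and an inequality on each of them adds up to one for the whole
  integral.\<close>

lemma integral_mono_fibres:
  fixes f g :: "'a \<Rightarrow> real"
  assumes "finite (h ` space M)"
    and fib: "\<And>\<omega>. \<omega> \<in> space M \<Longrightarrow> h -` {h \<omega>} \<inter> space M \<in> sets M"
    and int: "integrable M f" "integrable M g"
    and le: "\<And>\<omega>. \<omega> \<in> space M \<Longrightarrow>
      (\<integral>\<omega>'. indicator (h -` {h \<omega>} \<inter> space M) \<omega>' * f \<omega>' \<partial>M)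
        \<le> (\<integral>\<omega>'. indicator (h -` {h \<omega>} \<inter> space M) \<omega>' * g \<omega>' \<partial>M)"
  shows "integral\<^sup>L M f \<le> integral\<^sup>L M g"
proof -
  have eq: "integral\<^sup>L M f = (\<Sum>k\<in>h ` space M. \<integral>\<omega>. indicator (h -` {k} \<inter> space M) \<omega> * f \<omega> \<partial>M)"
    if "integrable M f" for f :: "'a \<Rightarrow> real"
  proof -
    have "integral\<^sup>L M f = (\<integral>\<omega>. (\<Sum>k\<in>h ` space M. indicator (h -` {k} \<inter> space M) \<omega> * f \<omega>) \<partial>M)"
    proof (rule Bochner_Integration.integral_cong)
      fix \<omega> assume "\<omega> \<in> space M"
      then have "(\<Sum>k\<in>h ` space M. indicator (h -` {k} \<inter> space M) \<omega> * f \<omega>) =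
          (\<Sum>k\<in>h ` space M. if k = h \<omega> then f \<omega> else 0)"
        by (intro sum.cong) auto
      also have "\<dots> = f \<omega>"
        using \<open>\<omega> \<in> space M\<close> assms(1) by (simp add: sum.delta')
      finally show "f \<omega> = (\<Sum>k\<in>h ` space M. indicator (h -` {k} \<inter> space M) \<omega> * f \<omega>)" by simp
    qed simp
    also have "\<dots> = (\<Sum>k\<in>h ` space M. \<integral>\<omega>. indicator (h -` {k} \<inter> space M) \<omega> * f \<omega> \<partial>M)"
    proof (rule Bochner_Integration.integral_sum)
      fix k assume "k \<in> h ` space M"
      then have "h -` {k} \<inter> space M \<in> sets M"
        using fib by auto
      then show "integrable M (\<lambda>\<omega>. indicator (h -` {k} \<inter> space M) \<omega> * f \<omega>)"
        using integrable_real_mult_indicator[OF _ that] by (simp add: mult.commute)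
    qed
    finally show ?thesis .
  qed
  show ?thesis
    unfolding eq[OF int(1)] eq[OF int(2)] using le by (intro sum_mono) auto
qed

end

section \<open>The potential is a supermartingale\<close>

context acl_process
begin

section \<open>Graph, depth and potential as functions of the outcome\<close>

abbreviation graph_at :: "nat \<Rightarrow> 'w \<Rightarrow> 'v vert mgraph" where
  "graph_at t \<omega> \<equiv> acl_graph G0 (\<lambda>s. Y s \<omega>) (\<lambda>s. N s \<omega>) (\<lambda>s. W s \<omega>) t"

abbreviation depth_at :: "nat \<Rightarrow> 'w \<Rightarrow> 'v vert \<Rightarrow> nat" where
  "depth_at t \<omega> \<equiv> depth (\<lambda>s. N s \<omega>) t"

text \<open>\<open>weight\<close> and \<open>total\<close> are the \<open>S\<close> and
  \<open>T\<close> of the supermartingale \<open>S/T^2\<close>.\<close>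

definition weight :: "nat \<Rightarrow> 'w \<Rightarrow> real" where
  "weight t \<omega> = edge_weight (\<lambda>v. 2 ^ depth_at t \<omega> v) (graph_at t \<omega>)"

definition total :: "nat \<Rightarrow> 'w \<Rightarrow> real" where
  "total t \<omega> = edge_weight (\<lambda>_. 1) (graph_at t \<omega>)"

text \<open>
  Two time bounds, because the samples of step \<open>t + 1\<close> are conditioned on \<open>history (t + 1) t\<close>.
\<close>
definition history :: "nat \<Rightarrow> nat \<Rightarrow> 'w \<Rightarrow>
    (nat \<Rightarrow> nat \<times> nat \<times> nat) \<times> (nat \<Rightarrow> 'v vert list \<times> ('v vert \<times> 'v vert) list)" where
  "history t t' \<omega> = (\<lambda>s\<in>{1..t}. (X s \<omega>, Y s \<omega>, Z s \<omega>), \<lambda>s\<in>{1..t'}. (N s \<omega>, W s \<omega>))"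

lemma history_eq_iff:
  "history t t' \<omega> = history t t' \<omega>' \<longleftrightarrow>
    (\<forall>s\<in>{1..t'}. N s \<omega> = N s \<omega>' \<and> W s \<omega> = W s \<omega>') \<and>
    (\<forall>s\<in>{1..t}. X s \<omega> = X s \<omega>' \<and> Y s \<omega> = Y s \<omega>' \<and> Z s \<omega> = Z s \<omega>')"
  by (auto simp: history_def restrict_def fun_eq_iff)

lemma history_fibre:
  "history t t' -` {history t t' \<omega>} \<inter> space M = {\<omega>' \<in> space M. history t t' \<omega>' = history t t' \<omega>}"
  by auto

lemma sets_eq_const:
  "f \<in> measurable M (count_space UNIV) \<Longrightarrow> {\<omega> \<in> space M. f \<omega> = c} \<in> sets M"
  using measurable_sets[of f M "count_space UNIV" "{c}"] by (simp add: vimage_def Int_def conj_commute)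

lemma sets_history_fibre:
  "history t t' -` {history t t' \<omega>} \<inter> space M \<in> sets M"
  unfolding history_fibre history_eq_iff
  by (intro sets.sets_Collect_conj sets.sets_Collect_finite_All sets_eq_const
        meas_X meas_Y meas_Z meas_N meas_W) auto

lemma sets_samples:
  "1 \<le> t \<Longrightarrow> {\<omega> \<in> space M. N t \<omega> = a \<and> W t \<omega> = b} \<in> sets M"
  by (intro sets.sets_Collect_conj sets_eq_const meas_N meas_W)

lemma finite_verts: "finite (verts (graph_at t \<omega>))"
  using G0_finite by (simp add: verts_acl_graph finite_mgraph_def)

lemma N_nonempty: "1 \<le> t \<Longrightarrow> \<omega> \<in> space M \<Longrightarrow> N t \<omega> \<noteq> []"
  using N_length[of t \<omega>] X_pos[of t \<omega>] by auto

lemma finite_mgraph_at: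
  assumes "\<omega> \<in> space M"
  shows "finite_mgraph (graph_at t \<omega>)"
proof (induction t)
  case 0
  show ?case
    using G0_finite by (auto simp: finite_mgraph_def init_graph_def uprod.set_map)
next
  case (Suc t)
  then show ?case
    using N_verts[of "Suc t" \<omega>] W_verts[of "Suc t" \<omega>] assms by (auto intro: finite_mgraph_step)
qed

lemma graph_at_cong: "history t t \<omega> = history t t \<omega>' \<Longrightarrow> graph_at t \<omega> = graph_at t \<omega>'"
  by (intro acl_graph_cong) (auto simp: history_eq_iff)

lemma depth_at_cong: "history t t \<omega> = history t t \<omega>' \<Longrightarrow> depth_at t \<omega> = depth_at t \<omega>'"
  by (intro depth_cong) (auto simp: history_eq_iff)

text \<open>\<open>T\<close> depends on \<open>X\<close>, \<open>Y\<close>, \<open>Z\<close> alone,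
  so \<open>total (Suc t)\<close> is already determined by \<open>history (Suc t) t\<close>, before
  the samples of that step are drawn.\<close>

lemma total_eq:
  assumes "\<omega> \<in> space M"
  shows "total t \<omega> = 2 * real (size (edges G0)) + 2 * (\<Sum>s = 1..t. real (X s \<omega> + Y s \<omega> + Z s \<omega>))"
proof -
  have "(\<Sum>s = 1..t. length (N s \<omega>) + Y s \<omega> + length (W s \<omega>)) = (\<Sum>s = 1..t. X s \<omega> + Y s \<omega> + Z s \<omega>)"
    using assms by (intro sum.cong) (auto simp: N_length W_length)
  then show ?thesis
    unfolding total_def edge_weight_const size_edges_acl_graph by simp
qed

lemma total_pos:
  assumes "\<omega> \<in> space M"
  shows "2 \<le> total t \<omega>"
proof -
  have "1 \<le> size (edges G0)"
    using G0_edge by (simp add: Suc_le_eq nonempty_has_size[symmetric])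
  then have "1 \<le> real (size (edges G0))" by linarith
  moreover have "0 \<le> (\<Sum>s = 1..t. real (X s \<omega> + Y s \<omega> + Z s \<omega>))"
    by (intro sum_nonneg) auto
  ultimately show ?thesis
    unfolding total_eq[OF assms] by linarith
qed

lemma weight_nonneg: "0 \<le> weight t \<omega>"
  unfolding weight_def by (rule edge_weight_nonneg) simp

text \<open>The new vertex has degree \<open>X + 2 Y\<close> and twice the weight of its parent,
  whence the coefficient \<open>2 X + 4 Y\<close>; old vertices keep their depth.\<close>

lemma weight_Suc:
  assumes "\<omega> \<in> space M"
  shows "weight (Suc t) \<omega> = weight t \<omega>
    + (2 * real (X (Suc t) \<omega>) + 4 * real (Y (Suc t) \<omega>)) * 2 ^ depth_at t \<omega> (hd (N (Suc t) \<omega>))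
    + (\<Sum>v\<leftarrow>N (Suc t) \<omega>. 2 ^ depth_at t \<omega> v)
    + (\<Sum>(w, w')\<leftarrow>W (Suc t) \<omega>. 2 ^ depth_at t \<omega> w + 2 ^ depth_at t \<omega> w')"
proof -
  have eq: "depth_at (Suc t) \<omega> v = depth_at t \<omega> v" if "v \<in> verts (graph_at t \<omega>)" for v
    using that by (auto simp: verts_acl_graph)
  have "edge_weight (\<lambda>v. 2 ^ depth_at (Suc t) \<omega> v) (graph_at t \<omega>) = weight t \<omega>"
    unfolding weight_def by (rule edge_weight_cong[OF finite_mgraph_at[OF assms]]) (simp add: eq del: depth.simps)
  moreover have mapN: "map (\<lambda>v. 2 ^ depth_at (Suc t) \<omega> v :: real) (N (Suc t) \<omega>) =
      map (\<lambda>v. 2 ^ depth_at t \<omega> v) (N (Suc t) \<omega>)"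
    using N_verts[of "Suc t" \<omega>] assms by (intro map_cong) (auto simp: eq simp del: depth.simps)
  moreover have mapW: "map (\<lambda>(w, w'). 2 ^ depth_at (Suc t) \<omega> w + 2 ^ depth_at (Suc t) \<omega> w' :: real) (W (Suc t) \<omega>) =
      map (\<lambda>(w, w'). 2 ^ depth_at t \<omega> w + 2 ^ depth_at t \<omega> w') (W (Suc t) \<omega>)"
    using W_verts[of "Suc t" \<omega>] assms by (intro map_cong) (auto simp: eq simp del: depth.simps)
  moreover have "depth_at (Suc t) \<omega> (Inr (Suc t)) = Suc (depth_at t \<omega> (hd (N (Suc t) \<omega>)))"
    by simp
  ultimately show ?thesis
    unfolding weight_def[of "Suc t"] acl_graph.simps edge_weight_step mapN mapW
    using N_length[of "Suc t" \<omega>] assms by (simp del: depth.simps add: algebra_simps)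
qed

section \<open>One step conditioned on the history\<close>

text \<open>The conditional law in multiplied-out form, which also holds on null atoms because both
  sides vanish there.\<close>

lemma prob_samples:
  fixes t :: nat and \<omega>0 :: 'w
  assumes "length a = X (Suc t) \<omega>0" "length b = Z (Suc t) \<omega>0"
  defines "A \<equiv> {\<omega> \<in> space M. history (Suc t) t \<omega> = history (Suc t) t \<omega>0}"
    and "p \<equiv> rho0 (graph_at t \<omega>0)"
  shows "prob (A \<inter> {\<omega> \<in> space M. N (Suc t) \<omega> = a \<and> W (Suc t) \<omega> = b}) =
    prob A * ((\<Prod>v\<leftarrow>a. p v) * (\<Prod>(w, w')\<leftarrow>b. p w * p w'))"
proof (cases "prob A = 0")
  case True
  have "prob (A \<inter> {\<omega> \<in> space M. N (Suc t) \<omega> = a \<and> W (Suc t) \<omega> = b}) \<le> prob A"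
    using sets_history_fibre[of "Suc t" t \<omega>0]
    by (intro finite_measure_mono) (auto simp: A_def history_fibre)
  with True show ?thesis
    by (simp add: measure_le_0_iff)
next
  case False
  \<comment> \<open>The past of \<omega>0 is continued by the prescribed outcome \<open>a\<close>,
    \<open>b\<close>, as \<open>cond_samples\<close> speaks of sequences rather than of the outcome
    of a single step.\<close>
  define ns where "ns = (\<lambda>s. N s \<omega>0)(Suc t := a)"
  define ws where "ws = (\<lambda>s. W s \<omega>0)(Suc t := b)"
  let ?P = "\<lambda>\<omega>. (\<forall>s\<in>{1..<Suc t}. N s \<omega> = ns s \<and> W s \<omega> = ws s) \<and>
    (\<forall>s\<in>{1..Suc t}. X s \<omega> = X s \<omega>0 \<and> Y s \<omega> = Y s \<omega>0 \<and> Z s \<omega> = Z s \<omega>0)"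
  have A: "A = {\<omega> \<in> space M. ?P \<omega>}"
    unfolding A_def history_eq_iff ns_def ws_def atLeastLessThanSuc_atLeastAtMost by auto
  have B: "A \<inter> {\<omega> \<in> space M. N (Suc t) \<omega> = a \<and> W (Suc t) \<omega> = b} =
      {\<omega> \<in> space M. (N (Suc t) \<omega> = ns (Suc t) \<and> W (Suc t) \<omega> = ws (Suc t)) \<and> ?P \<omega>}"
    unfolding A by (auto simp: ns_def ws_def)
  have G: "acl_graph G0 (\<lambda>s. Y s \<omega>0) ns ws (Suc t - 1) = graph_at t \<omega>0"
    unfolding diff_Suc_1 by (rule acl_graph_cong) (auto simp: ns_def ws_def)
  have "\<P>(\<omega> in M. N (Suc t) \<omega> = ns (Suc t) \<and> W (Suc t) \<omega> = ws (Suc t) \<bar> ?P \<omega>) =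
      (\<Prod>v\<leftarrow>ns (Suc t). p v) * (\<Prod>(w, w')\<leftarrow>ws (Suc t). p w * p w')"
    unfolding p_def G[symmetric]
  proof (rule cond_samples)
    show "0 < prob {\<omega> \<in> space M. ?P \<omega>}"
      using False unfolding A by (simp add: zero_less_measure_iff)
  qed (use assms in \<open>auto simp: ns_def ws_def\<close>)
  moreover have "ns (Suc t) = a" "ws (Suc t) = b"
    by (simp_all add: ns_def ws_def)
  ultimately show ?thesis
    using False unfolding cond_prob_def A[symmetric] B by (simp add: field_simps)
qed

text \<open>The bound \<open>u\<close> limits both the values of \<open>X\<close>, \<open>Y\<close>,
  \<open>Z\<close> and the lengths of the lists, whose entries come from a finite vertex
  set.\<close>

lemma bounded_history_finite:
  assumes "\<And>s \<omega>. 1 \<le> s \<Longrightarrow> \<omega> \<in> space M \<Longrightarrow> X s \<omega> + Y s \<omega> + Z s \<omega> \<le> u"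
  shows "finite (history t t' ` space M)"
proof -
  define V where "V = Inl ` verts G0 \<union> Inr ` {1..t'}"
  have V: "finite V"
    using G0_finite by (simp add: V_def finite_mgraph_def)
  let ?R = "(\<Pi>\<^sub>E s\<in>{1..t}. {..u} \<times> {..u} \<times> {..u}) \<times>
    (\<Pi>\<^sub>E s\<in>{1..t'}. {xs. set xs \<subseteq> V \<and> length xs \<le> u} \<times> {xs. set xs \<subseteq> V \<times> V \<and> length xs \<le> u})"
  have "history t t' \<omega> \<in> ?R" if \<omega>: "\<omega> \<in> space M" for \<omega>
  proof -
    have "X s \<omega> \<le> u" "Y s \<omega> \<le> u" "Z s \<omega> \<le> u" if "1 \<le> s" for s
      using assms[OF that \<omega>] by auto
    moreover have "set (N s \<omega>) \<subseteq> V \<and> set (W s \<omega>) \<subseteq> V \<times> V" if "1 \<le> s" "s \<le> t'" for s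
    proof -
      have "verts (graph_at (s - 1) \<omega>) \<subseteq> V"
        using that by (auto simp: verts_acl_graph V_def)
      then show ?thesis
        using N_verts[OF that(1) \<omega>] W_verts[OF that(1) \<omega>] by blast
    qed
    ultimately show ?thesis
      using N_length[OF _ \<omega>] W_length[OF _ \<omega>] by (auto simp: history_def PiE_iff)
  qed
  then have "history t t' ` space M \<subseteq> ?R" by blast
  moreover have "finite ?R"
    using V by (intro finite_cartesian_product finite_PiE finite_lists_length_le) auto
  ultimately show ?thesis
    by (rule finite_subset)
qed

lemma potential_integrable:
  assumes "\<And>s \<omega>. 1 \<le> s \<Longrightarrow> \<omega> \<in> space M \<Longrightarrow> X s \<omega> + Y s \<omega> + Z s \<omega> \<le> u"
  shows "integrable M (\<lambda>\<omega>. weight t \<omega> / (total t \<omega>)\<^sup>2)"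
proof (rule finite_fibres_integrable)
  show "finite (history t t ` space M)"
    by (rule bounded_history_finite) (fact assms)
next
  fix \<omega> \<omega>' assume "history t t \<omega> = history t t \<omega>'"
  then show "weight t \<omega> / (total t \<omega>)\<^sup>2 = weight t \<omega>' / (total t \<omega>')\<^sup>2"
    unfolding weight_def total_def by (simp only: graph_at_cong[of t \<omega> \<omega>'] depth_at_cong[of t \<omega> \<omega>'])
qed (rule sets_history_fibre)

text \<open>On \<open>A\<close> the values \<open>X\<close>, \<open>Y\<close>, \<open>Z\<close> of
  the step are known and its samples are open. The denominator is the constant \<open>T'^2\<close>,
  and the mean of the new weight is computed by summing over all outcomes of the samples.\<close>

lemma potential_step_atom:
  fixes t :: nat and \<omega>0 :: 'w
  assumes \<omega>0: "\<omega>0 \<in> space M"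
  defines "A \<equiv> {\<omega> \<in> space M. history (Suc t) t \<omega> = history (Suc t) t \<omega>0}"
  shows "(\<integral>\<omega>. indicator A \<omega> * (weight (Suc t) \<omega> / (total (Suc t) \<omega>)\<^sup>2) \<partial>M)
    \<le> (\<integral>\<omega>. indicator A \<omega> * (weight t \<omega> / (total t \<omega>)\<^sup>2) \<partial>M)"
proof -
  define x y z where "x = X (Suc t) \<omega>0" and "y = Y (Suc t) \<omega>0" and "z = Z (Suc t) \<omega>0"
  define V where "V = verts (graph_at t \<omega>0)"
  define p where "p = rho0 (graph_at t \<omega>0)"
  define f :: "'v vert \<Rightarrow> real" where "f v = 2 ^ depth_at t \<omega>0 v" for v
  define S T where "S = weight t \<omega>0" and "T = total t \<omega>0"
  define T' where "T' = T + 2 * real (x + y + z)"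
  define g where "g ns ws = S + (2 * real x + 4 * real y) * f (hd ns) + sum_list (map f ns)
    + (\<Sum>(w, w')\<leftarrow>ws. f w + f w')" for ns :: "'v vert list" and ws
  \<comment> \<open>\<open>L\<close> contains every possible outcome of the samples; the events
    \<open>B a b\<close> for \<open>(a, b)\<close> in \<open>L\<close> partition
    \<open>A\<close>.\<close>
  define L where "L = {ns. set ns \<subseteq> V \<and> length ns = x} \<times> {ws. set ws \<subseteq> V \<times> V \<and> length ws = z}"
  define B where "B a b = A \<inter> {\<omega> \<in> space M. N (Suc t) \<omega> = a \<and> W (Suc t) \<omega> = b}" for a b
  have finL: "finite L"
    using finite_verts unfolding L_def V_def
    by (intro finite_cartesian_product finite_lists_length_eq) auto
  have A: "A \<in> sets M"
    using sets_history_fibre[of "Suc t" t \<omega>0] by (simp add: A_def history_fibre)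
  have B: "B a b \<in> sets M" for a b
    unfolding B_def using A sets_samples[of "Suc t" a b] by auto
  have T: "2 \<le> T"
    unfolding T_def by (rule total_pos[OF \<omega>0])
  have S: "0 \<le> S"
    unfolding S_def by (rule weight_nonneg)
  have past: "X (Suc t) \<omega> = x" "Y (Suc t) \<omega> = y" "Z (Suc t) \<omega> = z" "graph_at t \<omega> = graph_at t \<omega>0"
    "depth_at t \<omega> = depth_at t \<omega>0" "weight t \<omega> = S" "total t \<omega> = T" if "\<omega> \<in> A" for \<omega>
  proof -
    have h: "history (Suc t) t \<omega> = history (Suc t) t \<omega>0"
      using that by (simp add: A_def)
    then show "X (Suc t) \<omega> = x" "Y (Suc t) \<omega> = y" "Z (Suc t) \<omega> = z"
      unfolding history_eq_iff x_def y_def z_def by auto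
    have h': "history t t \<omega> = history t t \<omega>0"
      using h by (auto simp: history_eq_iff)
    show 1: "graph_at t \<omega> = graph_at t \<omega>0" "depth_at t \<omega> = depth_at t \<omega>0"
      by (rule graph_at_cong[OF h'], rule depth_at_cong[OF h'])
    show "weight t \<omega> = S" "total t \<omega> = T"
      unfolding S_def T_def weight_def total_def 1 by simp_all
  qed
  have now: "(N (Suc t) \<omega>, W (Suc t) \<omega>) \<in> L"
    "weight (Suc t) \<omega> / (total (Suc t) \<omega>)\<^sup>2 = g (N (Suc t) \<omega>) (W (Suc t) \<omega>) / T'\<^sup>2" if "\<omega> \<in> A" for \<omega>
  proof -
    have \<omega>: "\<omega> \<in> space M"
      using that by (simp add: A_def)
    show "(N (Suc t) \<omega>, W (Suc t) \<omega>) \<in> L"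
      using N_verts[of "Suc t" \<omega>] W_verts[of "Suc t" \<omega>] N_length[of "Suc t" \<omega>] W_length[of "Suc t" \<omega>] \<omega> past[OF that]
      by (simp add: L_def V_def)
    have "total (Suc t) \<omega> = T'"
      using past[OF that] unfolding T'_def by (simp add: total_eq[OF \<omega>])
    moreover have "weight (Suc t) \<omega> = g (N (Suc t) \<omega>) (W (Suc t) \<omega>)"
      unfolding weight_Suc[OF \<omega>] past[OF that] g_def f_def ..
    ultimately show "weight (Suc t) \<omega> / (total (Suc t) \<omega>)\<^sup>2 = g (N (Suc t) \<omega>) (W (Suc t) \<omega>) / T'\<^sup>2"
      by simp
  qed
  have "(\<integral>\<omega>. indicator A \<omega> * (weight (Suc t) \<omega> / (total (Suc t) \<omega>)\<^sup>2) \<partial>M) =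
      (\<integral>\<omega>. (\<Sum>(a, b)\<in>L. indicator (B a b) \<omega> * (g a b / T'\<^sup>2)) \<partial>M)"
  proof (rule Bochner_Integration.integral_cong)
    fix \<omega> assume \<omega>: "\<omega> \<in> space M"
    show "indicator A \<omega> * (weight (Suc t) \<omega> / (total (Suc t) \<omega>)\<^sup>2) =
        (\<Sum>(a, b)\<in>L. indicator (B a b) \<omega> * (g a b / T'\<^sup>2))"
    proof (cases "\<omega> \<in> A")
      case True
      have "(\<Sum>(a, b)\<in>L. indicator (B a b) \<omega> * (g a b / T'\<^sup>2)) =
          (\<Sum>l\<in>L. if l = (N (Suc t) \<omega>, W (Suc t) \<omega>) then case l of (a, b) \<Rightarrow> g a b / T'\<^sup>2 else 0)"
        using True \<omega> by (intro sum.cong) (auto simp: B_def indicator_def)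
      also have "\<dots> = g (N (Suc t) \<omega>) (W (Suc t) \<omega>) / T'\<^sup>2"
        using now(1)[OF True] finL by (simp add: sum.delta)
      finally show ?thesis
        using True now(2)[OF True] by simp
    next
      case False
      then show ?thesis
        by (auto simp: B_def indicator_def intro!: sum.neutral[symmetric])
    qed
  qed simp
  also have "\<dots> = (\<Sum>(a, b)\<in>L. prob (B a b) * (g a b / T'\<^sup>2))"
  proof -
    have ind: "integrable M (\<lambda>\<omega>. indicator (B a b) \<omega> * c)" for a b and c :: real
      using B[of a b] by (intro integrable_mult_left integrable_real_indicator) (auto simp: emeasure_eq_measure)
    have "B a b \<inter> space M = B a b" for a b
      using sets.sets_into_space[OF B] by blast
    with ind show ?thesis
      unfolding case_prod_unfold by (subst Bochner_Integration.integral_sum) simp_all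
  qed
  also have "\<dots> = (\<Sum>(a, b)\<in>L. prob A / T'\<^sup>2 * (g a b * ((\<Prod>v\<leftarrow>a. p v) * (\<Prod>(w, w')\<leftarrow>b. p w * p w'))))"
  proof (intro sum.cong refl, clarify)
    fix a b assume "(a, b) \<in> L"
    then have "prob (B a b) = prob A * ((\<Prod>v\<leftarrow>a. p v) * (\<Prod>(w, w')\<leftarrow>b. p w * p w'))"
      unfolding B_def A_def p_def by (intro prob_samples) (auto simp: L_def x_def z_def)
    then show "prob (B a b) * (g a b / T'\<^sup>2) =
        prob A / T'\<^sup>2 * (g a b * ((\<Prod>v\<leftarrow>a. p v) * (\<Prod>(w, w')\<leftarrow>b. p w * p w')))"
      by simp
  qed
  also have "\<dots> = prob A / T'\<^sup>2 *
      (\<Sum>(a, b)\<in>L. g a b * ((\<Prod>v\<leftarrow>a. p v) * (\<Prod>(w, w')\<leftarrow>b. p w * p w')))"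
    unfolding sum_distrib_left by (simp add: case_prod_unfold)
  also have "(\<Sum>(a, b)\<in>L. g a b * ((\<Prod>v\<leftarrow>a. p v) * (\<Prod>(w, w')\<leftarrow>b. p w * p w'))) =
      S + (2 * real x + 4 * real y) * (S / T) + real x * (S / T) + 2 * real z * (S / T)"
  proof -
    have eq: "(\<Sum>v\<in>V. p v * h v) = edge_weight h (graph_at t \<omega>0) / T" for h
      unfolding V_def p_def T_def total_def by (rule sum_rho0[OF finite_mgraph_at[OF \<omega>0]])
    have "(\<Sum>v\<in>V. p v) = 1"
      using eq[of "\<lambda>_. 1"] T by (simp add: T_def total_def)
    moreover have "(\<Sum>v\<in>V. p v * f v) = S / T"
      using eq[of f] unfolding S_def weight_def f_def .
    moreover have "0 < x"
      using X_pos[OF _ \<omega>0, of "Suc t"] by (simp add: x_def)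
    ultimately show ?thesis
      unfolding L_def g_def
      using sum_independent_samples[where V = V and p = p and n = x and m = z and f = f] by simp
  qed
  also have "prob A / T'\<^sup>2 * \<dots> \<le> prob A * (S / T\<^sup>2)"
  proof -
    \<comment> \<open>The new vertex contributes \<open>2x + 4y\<close>, its sampled neighbours
      \<open>x\<close>, the sampled pairs \<open>2z\<close>. Loops have the largest coefficient,
      4.\<close>
    have "(3 * real x + 4 * real y + 2 * real z) * (S / T) \<le> 4 * real (x + y + z) * (S / T)"
      using S T by (intro mult_right_mono) auto
    then have "S + (2 * real x + 4 * real y) * (S / T) + real x * (S / T) + 2 * real z * (S / T)
        \<le> S + 4 * real (x + y + z) * (S / T)"
      by (simp add: algebra_simps)
    also have "\<dots> = S / T\<^sup>2 * (T\<^sup>2 + 4 * real (x + y + z) * T)"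
      using T by (simp add: field_simps power2_eq_square)
    also have "\<dots> \<le> S / T\<^sup>2 * T'\<^sup>2"
    proof (rule mult_left_mono)
      \<comment> \<open>The two sides differ by the square of \<open>2 m\<close>.\<close>
      have "T\<^sup>2 + 4 * m * T \<le> (T + 2 * m)\<^sup>2" for m :: real
        using zero_le_power2[of m] by (simp add: power2_sum power_mult_distrib)
      then show "T\<^sup>2 + 4 * real (x + y + z) * T \<le> T'\<^sup>2"
        unfolding T'_def .
    qed (use S in simp)
    finally have "S + (2 * real x + 4 * real y) * (S / T) + real x * (S / T) + 2 * real z * (S / T)
        \<le> S / T\<^sup>2 * T'\<^sup>2" .
    then have "prob A / T'\<^sup>2 * (S + (2 * real x + 4 * real y) * (S / T) + real x * (S / T) + 2 * real z * (S / T))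
        \<le> prob A / T'\<^sup>2 * (S / T\<^sup>2 * T'\<^sup>2)"
      by (intro mult_left_mono) auto
    also have "\<dots> = prob A * (S / T\<^sup>2)"
      using T by (simp add: T'_def)
    finally show ?thesis .
  qed
  also have "prob A * (S / T\<^sup>2) = (\<integral>\<omega>. indicator A \<omega> * (S / T\<^sup>2) \<partial>M)"
    using A by (simp add: Int_absorb2 sets.sets_into_space)
  also have "\<dots> = (\<integral>\<omega>. indicator A \<omega> * (weight t \<omega> / (total t \<omega>)\<^sup>2) \<partial>M)"
    by (intro Bochner_Integration.integral_cong) (auto simp: indicator_def past)
  finally show ?thesis .
qed

section \<open>Mean and tail of the potential\<close>

text \<open>Initially all depths are 0, so \<open>S = T\<close> and the potential is
  \<open>1/T\<close>, below 1. Each step is then compared atom by atom.\<close>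

lemma expectation_potential_le_1:
  assumes u: "\<And>s \<omega>. 1 \<le> s \<Longrightarrow> \<omega> \<in> space M \<Longrightarrow> X s \<omega> + Y s \<omega> + Z s \<omega> \<le> u"
  shows "expectation (\<lambda>\<omega>. weight t \<omega> / (total t \<omega>)\<^sup>2) \<le> 1"
proof (induction t)
  case 0
  have "expectation (\<lambda>\<omega>. weight 0 \<omega> / (total 0 \<omega>)\<^sup>2) \<le> expectation (\<lambda>\<omega>. 1)"
  proof (rule integral_mono[OF potential_integrable[OF u]])
    fix \<omega> assume "\<omega> \<in> space M"
    then have "2 \<le> total 0 \<omega>" by (rule total_pos)
    moreover have "weight 0 \<omega> = total 0 \<omega>"
      by (simp add: weight_def total_def)
    ultimately show "weight 0 \<omega> / (total 0 \<omega>)\<^sup>2 \<le> 1"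
      by (simp add: power2_eq_square)
  qed auto
  then show ?case
    by (simp add: prob_space)
next
  case (Suc t)
  have "expectation (\<lambda>\<omega>. weight (Suc t) \<omega> / (total (Suc t) \<omega>)\<^sup>2)
      \<le> expectation (\<lambda>\<omega>. weight t \<omega> / (total t \<omega>)\<^sup>2)"
  proof (rule integral_mono_fibres)
    show "finite (history (Suc t) t ` space M)"
      by (rule bounded_history_finite) (fact u)
  qed (use u potential_integrable sets_history_fibre potential_step_atom history_fibre in auto)
  with Suc show ?case by simp
qed

lemma prob_potential_ge:
  assumes u: "\<And>s \<omega>. 1 \<le> s \<Longrightarrow> \<omega> \<in> space M \<Longrightarrow> X s \<omega> + Y s \<omega> + Z s \<omega> \<le> u"
    and "0 < c"
  shows "prob {\<omega> \<in> space M. c \<le> weight t \<omega> / (total t \<omega>)\<^sup>2} \<le> 1 / c"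
proof -
  have "prob {\<omega> \<in> space M. c \<le> weight t \<omega> / (total t \<omega>)\<^sup>2} \<le>
      expectation (\<lambda>\<omega>. weight t \<omega> / (total t \<omega>)\<^sup>2) / c"
    using assms weight_nonneg
    by (intro integral_Markov_inequality_measure[OF potential_integrable[OF u] sets.top]) (auto intro!: AE_I2)
  also have "\<dots> \<le> 1 / c"
    using expectation_potential_le_1[OF u] \<open>0 < c\<close> by (intro divide_right_mono) auto
  finally show ?thesis .
qed

section \<open>From the potential to the diameter\<close>

lemma sets_history_event:
  assumes "\<And>s \<omega>. 1 \<le> s \<Longrightarrow> \<omega> \<in> space M \<Longrightarrow> X s \<omega> + Y s \<omega> + Z s \<omega> \<le> u"
    and "\<And>\<omega> \<omega>'. history t t \<omega> = history t t \<omega>' \<Longrightarrow> P \<omega> = P \<omega>'"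
  shows "{\<omega> \<in> space M. P \<omega>} \<in> sets M"
proof -
  have "P \<in> measurable M (count_space UNIV)"
    using bounded_history_finite[OF assms(1)] sets_history_fibre assms(2)
    by (rule finite_fibres_measurable)
  then show ?thesis by simp
qed

text \<open>With \<open>T \<le> a\<close> the hypothesis bounds every \<open>2 ^ depth\<close> by
  \<open>n a^2\<close>. Taking logarithms bounds the depths, and the diameter is at most twice that
  bound plus the contribution \<open>K^2\<close> of the initial graph.\<close>

lemma diameter_le_if_potential_less:
  assumes \<omega>: "\<omega> \<in> space M"
    and u: "\<And>s. 1 \<le> s \<Longrightarrow> X s \<omega> + Y s \<omega> + Z s \<omega> \<le> u"
    and K: "card (verts G0) \<le> K" "size (edges G0) \<le> K"
    and pos: "1 \<le> n" "1 \<le> u"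
    and less: "weight n \<omega> / (total n \<omega>)\<^sup>2 < real n"
  shows "ereal_of_enat (graph_diameter (graph_at n \<omega>))
    \<le> ereal (9 * ln (real n) + 6 * ln (real u) + (6 * ln (2 * (real K + 1)) + (real K)\<^sup>2))"
proof -
  \<comment> \<open>An upper bound for \<open>T\<close>: there are at most \<open>K + n u\<close>
    edges, and \<open>n u \<ge> 1\<close> allows the factored form.\<close>
  define a where "a = 2 * (real K + 1) * (real n * real u)"
  define q where "q = ln (real n) + 2 * (ln (2 * (real K + 1)) + (ln (real n) + ln (real u)))"
  \<comment> \<open>The factor \<open>3 / 2\<close> comes from \<open>ln 2 \<ge> 2 / 3\<close>.
    Hence the final bound has the leading terms of \<open>3 q\<close>, namely
    \<open>9 ln n + 6 ln u\<close>.\<close>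
  define d where "d = nat \<lfloor>3 / 2 * q\<rfloor>"
  have a: "1 \<le> a"
    using mult_mono[of 1 "2 * (real K + 1)" 1 "real n * real u"] mult_mono[of 1 "real n" 1 "real u"] pos
    by (simp add: a_def)
  have q: "0 \<le> q"
    using pos by (simp add: q_def)
  have ln_a: "ln (real n * a\<^sup>2) = q"
    using pos by (simp add: a_def q_def ln_mult ln_realpow)
  have "total n \<omega> \<le> a"
  proof -
    have "(\<Sum>s = 1..n. real (X s \<omega> + Y s \<omega> + Z s \<omega>)) \<le> (\<Sum>s = 1..n. real u)"
      using u by (intro sum_mono of_nat_mono) auto
    then have "total n \<omega> \<le> 2 * real K + 2 * (real n * real u)"
      unfolding total_eq[OF \<omega>] using K(2) by (simp del: of_nat_add)
    also have "\<dots> \<le> 2 * real K * (real n * real u) + 2 * (real n * real u)"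
      using mult_mono[of 1 "real n" 1 "real u"] pos mult_left_mono[of 1 "real n * real u" "2 * real K"] by simp
    finally show ?thesis
      by (simp add: a_def algebra_simps)
  qed
  have T: "2 \<le> total n \<omega>"
    by (rule total_pos[OF \<omega>])
  have "weight n \<omega> < real n * (total n \<omega>)\<^sup>2"
    using less T by (simp add: divide_less_eq)
  also have "\<dots> \<le> real n * a\<^sup>2"
    using \<open>total n \<omega> \<le> a\<close> T by (intro mult_left_mono power_mono) auto
  finally have weight: "weight n \<omega> < real n * a\<^sup>2" .
  have depth: "depth_at n \<omega> v \<le> d" if "v \<in> verts (graph_at n \<omega>)" for v
  proof -
    have "(2::real) ^ depth_at n \<omega> v \<le> real n * a\<^sup>2"
    proof (cases v)
      \<comment> \<open>Initial vertices have depth 0, so \<open>1 \<le> n a^2\<close> is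
        enough.\<close>
      case (Inl b)
      then show ?thesis
        using mult_mono[of 1 "real n" 1 "a\<^sup>2"] pos a by simp
    next
      case (Inr s)
      with that have "1 \<le> s" "s \<le> n"
        by (auto simp: verts_acl_graph)
      then have "2 ^ depth_at n \<omega> v \<le> weight n \<omega>"
        unfolding weight_def Inr using N_nonempty[OF _ \<omega>] by (intro depth_le_edge_weight) auto
      with weight show ?thesis by simp
    qed
    then have "ln (2 ^ depth_at n \<omega> v) \<le> q"
      unfolding ln_a[symmetric] using pos a by (subst ln_le_cancel_iff) auto
    then have "real (depth_at n \<omega> v) * ln 2 \<le> q"
      by (simp add: ln_realpow)
    moreover have "real (depth_at n \<omega> v) * (2 / 3) \<le> real (depth_at n \<omega> v) * ln 2"
      using ln2_ge_two_thirds by (intro mult_left_mono) auto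
    ultimately have "real (depth_at n \<omega> v) \<le> 3 / 2 * q"
      by simp
    then show ?thesis
      unfolding d_def by linarith
  qed
  have "graph_diameter (graph_at n \<omega>) \<le> enat (2 * d + (card (verts G0))\<^sup>2)"
  proof (rule diameter_acl_graph_le[OF G0_finite G0_connected _ depth])
    fix s assume "1 \<le> s" "s \<le> n"
    then show "N s \<omega> \<noteq> [] \<and> set (N s \<omega>) \<subseteq> verts (graph_at (s - 1) \<omega>)"
      using N_nonempty[OF _ \<omega>] N_verts[OF _ \<omega>] by auto
  qed
  also have "enat (2 * d + (card (verts G0))\<^sup>2) \<le> enat (2 * d + K\<^sup>2)"
    using K(1) by (simp add: power_mono)
  finally have "ereal_of_enat (graph_diameter (graph_at n \<omega>)) \<le> ereal_of_enat (enat (2 * d + K\<^sup>2))"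
    by (simp only: ereal_of_enat_le_iff)
  also have "\<dots> = ereal (real (2 * d + K\<^sup>2))"
    by (simp del: of_nat_add)
  also have "real (2 * d + K\<^sup>2) \<le> 3 * q + (real K)\<^sup>2"
  proof -
    have "real d \<le> 3 / 2 * q"
      unfolding d_def by (rule of_nat_floor) (use q in simp)
    then show ?thesis by simp
  qed
  also have "\<dots> = 9 * ln (real n) + 6 * ln (real u) + (6 * ln (2 * (real K + 1)) + (real K)\<^sup>2)"
    by (simp add: q_def algebra_simps)
  finally show ?thesis
    by simp
qed

text \<open>Markov's inequality with threshold \<open>n\<close>: the failure probability
  \<open>1/n\<close> vanishes, while the threshold adds only a multiple of \<open>ln n\<close> to
  the bound.\<close>

lemma prob_diameter_le:
  assumes u: "\<And>s \<omega>. 1 \<le> s \<Longrightarrow> \<omega> \<in> space M \<Longrightarrow> X s \<omega> + Y s \<omega> + Z s \<omega> \<le> u"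
    and K: "card (verts G0) \<le> K" "size (edges G0) \<le> K"
    and pos: "1 \<le> n" "1 \<le> u"
    and R: "9 * ln (real n) + 6 * ln (real u) + (6 * ln (2 * (real K + 1)) + (real K)\<^sup>2) \<le> R"
  shows "1 - 1 / real n \<le> \<P>(\<omega> in M.
    ereal_of_enat (graph_diameter (acl_random_graph G0 Y N W n \<omega>)) \<le> ereal R)"
proof -
  let ?E = "{\<omega> \<in> space M. ereal_of_enat (graph_diameter (acl_random_graph G0 Y N W n \<omega>)) \<le> ereal R}"
  let ?B = "{\<omega> \<in> space M. real n \<le> weight n \<omega> / (total n \<omega>)\<^sup>2}"
  have E: "?E \<in> sets M"
  proof (rule sets_history_event[OF u])
    fix \<omega> \<omega>' assume "history n n \<omega> = history n n \<omega>'"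
    then show "(ereal_of_enat (graph_diameter (acl_random_graph G0 Y N W n \<omega>)) \<le> ereal R) =
        (ereal_of_enat (graph_diameter (acl_random_graph G0 Y N W n \<omega>')) \<le> ereal R)"
      unfolding acl_random_graph_def by (simp only: graph_at_cong[of n \<omega> \<omega>'])
  qed
  have B: "?B \<in> sets M"
    using borel_measurable_integrable[OF potential_integrable[OF u]] by simp
  have "1 - 1 / real n \<le> 1 - prob ?B"
    using prob_potential_ge[OF u, of "real n" n] pos by simp
  also have "\<dots> = prob (space M - ?B)"
    using B by (simp add: prob_compl)
  also have "\<dots> \<le> prob ?E"
  proof (rule finite_measure_mono[OF _ E], rule subsetI)
    fix \<omega> assume \<omega>: "\<omega> \<in> space M - ?B"
    then have "ereal_of_enat (graph_diameter (graph_at n \<omega>))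
        \<le> ereal (9 * ln (real n) + 6 * ln (real u) + (6 * ln (2 * (real K + 1)) + (real K)\<^sup>2))"
      using K pos u by (intro diameter_le_if_potential_less) auto
    also have "\<dots> \<le> ereal R"
      using R by simp
    finally show "\<omega> \<in> ?E"
      using \<omega> by (simp add: acl_random_graph_def)
  qed
  finally show ?thesis .
qed

end

section \<open>Comparison with the claimed bound and passage to the limit\<close>

theorem theorem3p2:
  fixes M :: "nat \<Rightarrow> 'w measure"
    and G0 :: "nat \<Rightarrow> 'v mgraph"
    and X Y Z :: "nat \<Rightarrow> nat \<Rightarrow> 'w \<Rightarrow> nat"
    and N :: "nat \<Rightarrow> nat \<Rightarrow> 'w \<Rightarrow> 'v vert list"
    and W :: "nat \<Rightarrow> nat \<Rightarrow> 'w \<Rightarrow> ('v vert \<times> 'v vert) list"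
    and l u :: "nat \<Rightarrow> nat"
    and K :: nat
  assumes process: "\<And>n. acl_process (M n) (G0 n) (X n) (Y n) (Z n) (N n) (W n)"
    and G0_size: "\<And>n. card (verts (G0 n)) \<le> K \<and> size (edges (G0 n)) \<le> K"
    and pos: "\<And>n. 0 < l n \<and> 0 < u n"
    and bounds: "\<And>n t \<omega>. 1 \<le> t \<Longrightarrow> \<omega> \<in> space (M n) \<Longrightarrow>
      0 < X n t \<omega> \<and> l n \<le> X n t \<omega> + Y n t \<omega> + Z n t \<omega> \<and> X n t \<omega> + Y n t \<omega> + Z n t \<omega> \<le> u n"
  shows "\<exists>C :: real.
    (\<lambda>n. \<P>(\<omega> in M n.
        ereal_of_enat (graph_diameter (acl_random_graph (G0 n) (Y n) (N n) (W n) n \<omega>))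
          \<le> ereal (4 * exp 1 * (real (u n) / real (l n)) * ln (real n) + 8 * exp 1 * real (u n) + C)))
      \<longlonglongrightarrow> 1"
proof
  \<comment> \<open>The constant depends only on the uniform size bound \<open>K\<close> of the
    initial graphs.\<close>
  let ?C = "6 * ln (2 * (real K + 1)) + (real K)\<^sup>2"
  let ?R = "\<lambda>n. 4 * exp 1 * (real (u n) / real (l n)) * ln (real n) + 8 * exp 1 * real (u n) + ?C"
  let ?p = "\<lambda>n. \<P>(\<omega> in M n.
    ereal_of_enat (graph_diameter (acl_random_graph (G0 n) (Y n) (N n) (W n) n \<omega>)) \<le> ereal (?R n))"
  have lower: "1 - 1 / real n \<le> ?p n" if n: "1 \<le> n" for n
  proof -
    interpret acl_process "M n" "G0 n" "X n" "Y n" "Z n" "N n" "W n"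
      by (rule process)
    \<comment> \<open>A probability space is nonempty; any outcome at time 1 yields
      \<open>l \<le> u\<close>.\<close>
    obtain \<omega> where "\<omega> \<in> space (M n)"
      using not_empty by blast
    then have "l n \<le> u n"
      using bounds[of 1 \<omega> n] by linarith
    then have "1 \<le> real (u n) / real (l n)"
      using pos[of n] by simp
    \<comment> \<open>The quadratic Taylor bound \<open>1 + 1 + 1/2\<close> gives
      \<open>4 e \<ge> 10\<close>, enough to absorb the 9 in front of \<open>ln n\<close>.\<close>
    moreover have e: "5 / 2 \<le> exp (1 :: real)"
      using exp_lower_Taylor_quadratic[of 1] by simp
    ultimately have "9 \<le> 4 * exp 1 * (real (u n) / real (l n))"
      using mult_mono[of "9 :: real" "4 * exp 1" 1 "real (u n) / real (l n)"] by simp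
    then have "9 * ln (real n) \<le> 4 * exp 1 * (real (u n) / real (l n)) * ln (real n)"
      using n by (intro mult_right_mono) auto
    moreover have "6 * ln (real (u n)) \<le> 8 * exp 1 * real (u n)"
    proof -
      have "6 * ln (real (u n)) \<le> 6 * real (u n)"
        using ln_le_minus_one[of "real (u n)"] pos[of n] by simp
      also have "\<dots> \<le> 8 * exp 1 * real (u n)"
        using e by (intro mult_right_mono) auto
      finally show ?thesis .
    qed
    ultimately show ?thesis
      using bounds G0_size[of n] pos[of n] n
      by (intro prob_diameter_le[where u = "u n" and K = K]) auto
  qed
  show "?p \<longlonglongrightarrow> 1"
  proof (rule tendsto_sandwich[of "\<lambda>n. 1 - 1 / real n" _ _ "\<lambda>_. 1"])
    show "\<forall>\<^sub>F n in sequentially. 1 - 1 / real n \<le> ?p n"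
      using eventually_ge_at_top[of 1] by eventually_elim (rule lower)
    have "prob_space (M n)" for n
      using process[of n] by (simp add: acl_process_def)
    then show "\<forall>\<^sub>F n in sequentially. ?p n \<le> 1"
      by (intro always_eventually allI prob_space.prob_le_1)
    have "(\<lambda>n. 1 / real n) \<longlonglongrightarrow> 0"
      by (rule lim_1_over_n)
    then show "(\<lambda>n. 1 - 1 / real n) \<longlonglongrightarrow> 1"
      using tendsto_diff[OF tendsto_const[of "1 :: real"]] by fastforce
  qed simp
qed

end
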